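(* Let $F\in\mathcal D$. Assume that $F$ is not the zero function and that $\int_0^{\infty}F(t)\,dt<+\infty$. Then there exists a constant $\gamma\in\mathbb R$, depending on $F$, such that $$\widehat{T^{2k}F}\xrightarrow[k\to\infty]{}\gamma\quad\text{and}\quad \widehat{T^{2k+1}F}\xrightarrow[k\to\infty]{}-\gamma,\qquad\text{uniformly on }\mathbb R.$$ In particular, $$T^{2k}F\xrightarrow[k\to\infty]{}\theta_\gamma F^*\quad\text{and}\quad T^{2k+1}F\xrightarrow[k\to\infty]{}\theta_{-\gamma}F^*,\qquad\text{uniformly on }\mathbb R.$$ (In the excluded cases, i.e. if $F=0$ or $\int_0^\infty F=+\infty$, the sequence $(T^kF)_{k\ge1}$ alternates between the constant functions $0$ and $1$.)
   Context: $\mathcal D$ is the set of non-increasing functions $F\colon\mathbb R\to[0,1]$ that are right-continuous with left limits (tail distribution functions $x\mapsto\mathbb P(X>x)$ of $[-\infty,+\infty]$-valued random variables). The operator $T\colon\mathcal D\to\mathcal D$ is $$TF(x)=\exp\Big(-\int_{-x}^{+\infty}F(t)\,dt\Big),\qquad \exp(-\infty)=0,$$ and $T^k$ is its $k$-th iterate. $F^*(x)=\frac1{1+e^x}$ is the logistic tail function, and for $t\in\mathbb R$, $\theta_tF(x)=F(x-t)$. For $F\in\mathcal D$, the transform $\widehat F$ is $\widehat F(x)=x+\ln\frac{F(x)}{1-F(x)}$, with values in $[-\infty,+\infty]$. *)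

theory Defs
  imports "HOL-Analysis.Analysis"
begin

definition tail_functions :: "(real \<Rightarrow> real) set" where
  "tail_functions =
     {F. antimono F \<and> (\<forall>x. F x \<in> {0..1}) \<and>
         (\<forall>x. continuous (at_right x) F) \<and> (\<forall>x. \<exists>l. (F \<longlongrightarrow> l) (at_left x))}"

text \<open>The function \<open>a \<mapsto> exp (- a)\<close> on \<open>[0, \<infinity>]\<close>, with \<open>exp (- \<infinity>) = 0\<close>.\<close>

definition exp_minus :: "ennreal \<Rightarrow> real" where
  "exp_minus a = (if a = \<infinity> then 0 else exp (- enn2real a))"

definition T_op :: "(real \<Rightarrow> real) \<Rightarrow> real \<Rightarrow> real" where
  "T_op F x = exp_minus (\<integral>\<^sup>+t\<in>{-x..}. ennreal (F t) \<partial>lborel)"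

definition logistic_tail :: "real \<Rightarrow> real" where
  "logistic_tail x = 1 / (1 + exp x)"

definition shift :: "real \<Rightarrow> (real \<Rightarrow> real) \<Rightarrow> real \<Rightarrow> real" where
  "shift t F x = F (x - t)"

text \<open>The values at \<open>F x = 0\<close> and \<open>F x = 1\<close> are fixed by
  \<open>ln 0 = -\<infinity>\<close> and \<open>ln (1 / 0) = +\<infinity>\<close>, which differs from the
  totalised real \<open>ln\<close> and division.\<close>

definition hat :: "(real \<Rightarrow> real) \<Rightarrow> real \<Rightarrow> ereal" where
  "hat F x =
     (if F x = 0 then - \<infinity>
      else if F x = 1 then \<infinity>
      else ereal (x + ln (F x / (1 - F x))))"

text \<open>Uniform convergence on the real line of extended-real-valued functions to a finite
  constant. As \<open>\<bar>\<plusminus>\<infinity> - c\<bar> = \<infinity>\<close>, it forces the functions to be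
  everywhere finite from some index on. The library's \<open>uniform_limit\<close> is not available
  here because \<open>ereal\<close> is not an instance of \<open>metric_space\<close>.\<close>

definition unif_tendsto_const :: "(nat \<Rightarrow> real \<Rightarrow> ereal) \<Rightarrow> real \<Rightarrow> bool" where
  "unif_tendsto_const f c \<longleftrightarrow>
     (\<forall>\<epsilon>>0. \<forall>\<^sub>F k in sequentially. \<forall>x. \<bar>f k x - ereal c\<bar> < ereal \<epsilon>)"

end

theory Submission
  imports Defs
begin

text \<open>
  The shifted logistic tails form a \<open>T\<close>-stable family, and \<open>T\<close> is order reversing, so the
  best bounds \<open>m\<close> and \<open>M\<close> with \<open>\<theta>\<^sub>m F\<^sup>* \<le> T\<^sup>2\<^sup>k F \<le> \<theta>\<^sub>M F\<^sup>*\<close> improve with \<open>k\<close>. At the point \<open>0\<close>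
  the iterate is far from one of its two bounds, and by monotonicity it stays
  far from it on an interval. This gains a factor \<open>K\<close> in the bound for \<open>T F\<close> on a half line, which
  a second application of \<open>T\<close> turns, by Bernoulli's inequality, into a uniform improvement of that
  bound. The gain depends continuously on the bound, so the limits of \<open>m\<close> and \<open>M\<close>
  coincide. Finite bounds exist from the sixth iterate on: \<open>T F\<close> decays exponentially,
  hence \<open>1 - T\<^sup>2 F\<close> does so at \<open>-\<infinity>\<close>, hence \<open>T\<^sup>3 F(x) = O(e\<^sup>-\<^sup>x)\<close>, which bounds \<open>T\<^sup>4 F\<close> from below
  by a shifted logistic tail.
\<close>

lemma mult_ln_one_plus_le:
  fixes t u :: real
  assumes "0 \<le> t" "t \<le> 1" "0 \<le> u"
  shows "t * ln (1 + u) \<le> ln (1 + t * u)"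
proof -
  have "(1 - t) * ln 1 + t * ln (1 + u) \<le> ln ((1 - t) *\<^sub>R 1 + t *\<^sub>R (1 + u))"
    using concave_onD[OF ln_concave, of t 1 "1 + u"] assms by auto
  then show ?thesis by (simp add: algebra_simps)
qed

definition tail_integral :: "(real \<Rightarrow> real) \<Rightarrow> real \<Rightarrow> ennreal" where
  "tail_integral F y = (\<integral>\<^sup>+t\<in>{y..}. ennreal (F t) \<partial>lborel)"

lemma T_op_tail_integral: "T_op F x = exp_minus (tail_integral F (- x))"
  by (simp add: T_op_def tail_integral_def)

lemma exp_minus_le:
  assumes "ennreal r \<le> a" "0 \<le> r"
  shows "exp_minus a \<le> exp (- r)"
proof (cases a)
  case (real q)
  then show ?thesis using assms by (simp add: exp_minus_def ennreal_le_iff)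
qed (simp add: exp_minus_def)

lemma exp_minus_ge:
  assumes "a \<le> ennreal r" "0 \<le> r"
  shows "exp (- r) \<le> exp_minus a"
proof (cases a)
  case (real q)
  then show ?thesis using assms by (simp add: exp_minus_def ennreal_le_iff)
next
  case top
  then show ?thesis using assms by (simp add: top_unique)
qed

lemma exp_minus_antimono: "a \<le> b \<Longrightarrow> exp_minus b \<le> exp_minus a"
  by (cases a; cases b) (auto simp: exp_minus_def top_unique ennreal_le_iff)

lemma exp_minus_bounds: "0 \<le> exp_minus a" "exp_minus a \<le> 1"
  by (auto simp: exp_minus_def)

lemma tail_integral_mono:
  assumes "\<And>t. y \<le> t \<Longrightarrow> F t \<le> G t"
  shows "tail_integral F y \<le> tail_integral G y"
  unfolding tail_integral_def
  by (intro nn_integral_mono) (auto simp: indicator_def assms ennreal_leI)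

lemma tail_integral_antimono: "y \<le> z \<Longrightarrow> tail_integral F z \<le> tail_integral F y"
  unfolding tail_integral_def by (intro nn_integral_mono) (auto simp: indicator_def)

lemma T_op_bounds: "0 \<le> T_op F x" "T_op F x \<le> 1"
  by (simp_all add: T_op_tail_integral exp_minus_bounds)

lemma antimono_T_op: "antimono (T_op F)"
  by (intro antimonoI) (auto simp: T_op_tail_integral intro!: exp_minus_antimono tail_integral_antimono)

lemma antimono_measurable:
  fixes F :: "real \<Rightarrow> real"
  assumes "antimono F"
  shows "F \<in> borel_measurable borel"
proof -
  have "mono (\<lambda>x. - F x)" using assms by (auto simp: mono_def antimono_def)
  then have "(\<lambda>x. - (- F x)) \<in> borel_measurable borel"
    by (intro borel_measurable_uminus borel_measurable_mono)
  then show ?thesis by simp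
qed

lemma tail_integral_add:
  assumes "F \<in> borel_measurable borel" "G \<in> borel_measurable borel"
    "\<And>t. 0 \<le> F t" "\<And>t. 0 \<le> G t"
  shows "tail_integral (\<lambda>t. F t + G t) y = tail_integral F y + tail_integral G y"
  unfolding tail_integral_def using assms
  by (subst nn_integral_add[symmetric]) (auto simp: distrib_right ennreal_plus intro!: nn_integral_cong)

lemma tail_integral_cmult:
  assumes "F \<in> borel_measurable borel" "0 \<le> c"
  shows "tail_integral (\<lambda>t. c * F t) y = ennreal c * tail_integral F y"
  unfolding tail_integral_def using assms
  by (subst nn_integral_cmult[symmetric]) (auto simp: ennreal_mult' mult.assoc intro!: nn_integral_cong)

lemma tail_integral_indicator:
  assumes "a \<le> b" "y \<le> a" "0 \<le> c"
  shows "tail_integral (\<lambda>t. c * indicator {a..b} t) y = ennreal (c * (b - a))"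
proof -
  have "tail_integral (\<lambda>t. c * indicator {a..b} t) y
      = (\<integral>\<^sup>+ t. ennreal c * indicator {a..b} t \<partial>lborel)"
    unfolding tail_integral_def using assms
    by (intro nn_integral_cong) (auto simp: indicator_def)
  then show ?thesis using assms by (simp add: nn_integral_cmult_indicator ennreal_mult')
qed

lemma logistic_tail_pos: "0 < logistic_tail x"
  by (simp add: logistic_tail_def add_pos_pos)

lemma logistic_tail_less_1: "logistic_tail x < 1"
  by (simp add: logistic_tail_def add_pos_pos)

lemma logistic_tail_strict_antimono: "x < y \<Longrightarrow> logistic_tail y < logistic_tail x"
  by (simp add: logistic_tail_def divide_strict_left_mono add_pos_pos)

lemma logistic_tail_antimono: "x \<le> y \<Longrightarrow> logistic_tail y \<le> logistic_tail x"
  using logistic_tail_strict_antimono[of x y] by (cases "x = y") auto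

lemma logistic_tail_cont: "continuous_on UNIV logistic_tail"
  unfolding logistic_tail_def
  by (intro continuous_intros) (metis add_pos_pos exp_gt_zero less_numeral_extra(1,3))

lemma logistic_tail_measurable [measurable]: "(\<lambda>t. logistic_tail (t - b)) \<in> borel_measurable borel"
  unfolding logistic_tail_def by measurable

lemma tail_integral_logistic:
  "tail_integral (\<lambda>t. logistic_tail (t - b)) y = ennreal (ln (1 + exp (b - y)))"
proof -
  have "((\<lambda>t. - ln (1 + exp (b - t))) has_real_derivative logistic_tail (t - b)) (at t)" for t
  proof -
    have "((\<lambda>t. - ln (1 + exp (b - t))) has_real_derivative exp (b - t) / (1 + exp (b - t))) (at t)"
      by (auto intro!: derivative_eq_intros simp: add_pos_pos)
    moreover have "exp (b - t) / (1 + exp (b - t)) = logistic_tail (t - b)"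
      by (simp add: logistic_tail_def exp_diff field_simps)
    ultimately show ?thesis by simp
  qed
  moreover have "((\<lambda>t. exp b * inverse (exp t)) \<longlongrightarrow> exp b * 0) at_top"
    by (intro tendsto_intros tendsto_inverse_0_at_top exp_at_top)
  then have "((\<lambda>t. exp (b - t)) \<longlongrightarrow> 0) at_top"
    by (simp add: exp_diff divide_inverse)
  then have "((\<lambda>t. - ln (1 + exp (b - t))) \<longlongrightarrow> - ln (1 + 0)) at_top"
    by (intro tendsto_intros) auto
  ultimately show ?thesis
    unfolding tail_integral_def
    by (subst nn_integral_FTC_atLeast[where F = "\<lambda>t. - ln (1 + exp (b - t))" and T = 0])
      (auto simp: less_imp_le logistic_tail_pos)
qed

lemma T_op_le_logistic:
  assumes "ennreal (ln (1 + exp (x - b))) \<le> tail_integral F (- x)"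
  shows "T_op F x \<le> logistic_tail (x - b)"
proof -
  have "T_op F x \<le> exp (- ln (1 + exp (x - b)))"
    unfolding T_op_tail_integral using assms by (intro exp_minus_le) auto
  then show ?thesis by (simp add: exp_minus logistic_tail_def add_pos_pos divide_inverse)
qed

lemma T_op_ge_logistic:
  assumes "tail_integral F (- x) \<le> ennreal (ln (1 + exp (x - b)))"
  shows "logistic_tail (x - b) \<le> T_op F x"
proof -
  have "exp (- ln (1 + exp (x - b))) \<le> T_op F x"
    unfolding T_op_tail_integral using assms by (intro exp_minus_ge) auto
  then show ?thesis by (simp add: exp_minus logistic_tail_def add_pos_pos divide_inverse)
qed

lemma T_op_ge_of_le:
  assumes "\<And>t. F t \<le> logistic_tail (t - b)"
  shows "logistic_tail (x + b) \<le> T_op F x"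
  using tail_integral_mono[of "-x" F "\<lambda>t. logistic_tail (t - b)"] assms
  using T_op_ge_logistic[of F x "-b"] by (simp add: tail_integral_logistic add.commute)

lemma T_op_le_of_ge:
  assumes "\<And>t. logistic_tail (t - a) \<le> F t"
  shows "T_op F x \<le> logistic_tail (x + a)"
  using tail_integral_mono[of "-x" "\<lambda>t. logistic_tail (t - a)" F] assms
  using T_op_le_logistic[of x "-a" F] by (simp add: tail_integral_logistic add.commute)

lemma tail_integral_restrict:
  assumes "y \<le> z"
  shows "tail_integral (\<lambda>t. F t * indicator {z..} t) y = tail_integral F z"
  unfolding tail_integral_def using assms
  by (intro nn_integral_cong) (auto simp: indicator_def)

lemma tail_integral_add_cmult_restrict:
  assumes F: "F \<in> borel_measurable borel" "\<And>t. 0 \<le> F t"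
    and G: "G \<in> borel_measurable borel" "\<And>t. 0 \<le> G t" and "0 \<le> c" "y \<le> z"
  shows "tail_integral (\<lambda>t. F t + c * (G t * indicator {z..} t)) y
    = tail_integral F y + ennreal c * tail_integral G z"
proof -
  have meas: "(\<lambda>t. G t * indicator {z..} t) \<in> borel_measurable borel"
    using G by measurable
  then show ?thesis
    using assms by (subst tail_integral_add) (auto simp: tail_integral_cmult tail_integral_restrict)
qed

text \<open>
  Here \<open>\<kappa>\<close> bounds from below the area between \<open>F\<close> and its bound \<open>\<theta>\<^sub>b F\<^sup>*\<close> over \<open>[0, d]\<close> (for the lower bound, \<open>\<theta>\<^sub>a F\<^sup>*\<close>
  over \<open>[-d, 0]\<close>). The two terms of the minimum are the improvements of the bound on \<open>T\<^sup>2 F\<close> on the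
  two sides of the point beyond which the improved bound on \<open>T F\<close> holds.
\<close>

definition upper_gain :: "real \<Rightarrow> real \<Rightarrow> real" where
  "upper_gain d b =
     (let \<kappa> = d * (logistic_tail (d - b) - logistic_tail (2 * d - b))
      in min \<kappa> ((exp \<kappa> - 1) * ln (1 + exp (- b))))"

definition lower_gain :: "real \<Rightarrow> real \<Rightarrow> real" where
  "lower_gain d a =
     (let \<kappa> = d * (logistic_tail (- 2 * d - a) - logistic_tail (- d - a))
      in min \<kappa> ((1 - exp (- \<kappa>)) * ln (1 + exp (- a - d))))"

lemma T_op_T_op_le:
  assumes F: "antimono F" "\<And>t. 0 \<le> F t" "\<And>t. F t \<le> logistic_tail (t - b)"
    and d: "0 < d" and F0: "F 0 \<le> logistic_tail (2 * d - b)"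
  shows "T_op (T_op F) x \<le> logistic_tail (x - (b - upper_gain d b))"
proof -
  define c where "c = logistic_tail (d - b) - logistic_tail (2 * d - b)"
  define \<kappa> where "\<kappa> = d * c"
  define K where "K = exp \<kappa>"
  define \<epsilon> where "\<epsilon> = upper_gain d b"
  have c: "0 \<le> c" using d by (simp add: c_def logistic_tail_antimono)
  have \<kappa>: "0 \<le> \<kappa>" using c d by (simp add: \<kappa>_def)
  have K: "1 \<le> K" using \<kappa> by (simp add: K_def)
  have \<epsilon>: "\<epsilon> \<le> \<kappa>" "\<epsilon> \<le> (K - 1) * ln (1 + exp (- b))"
    by (simp_all add: \<epsilon>_def upper_gain_def Let_def K_def \<kappa>_def c_def)
  have \<epsilon>0: "0 \<le> \<epsilon>"
    using \<kappa> by (simp add: \<epsilon>_def upper_gain_def Let_def flip: c_def \<kappa>_def)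
  have TF: "K * logistic_tail (x + b) \<le> T_op F x" if "0 \<le> x" for x
  proof -
    have le: "F t + c * indicator {0..d} t \<le> logistic_tail (t - b)" for t
    proof (cases "t \<in> {0..d}")
      case True
      then have "F t \<le> F 0" "logistic_tail (d - b) \<le> logistic_tail (t - b)"
        using F(1) by (auto simp: antimono_def logistic_tail_antimono)
      then show ?thesis using True F0 by (simp add: c_def)
    qed (simp add: F)
    have "tail_integral F (- x) + ennreal \<kappa> = tail_integral (\<lambda>t. F t + c * indicator {0..d} t) (- x)"
      using that d c F
      by (subst tail_integral_add)
        (auto simp: tail_integral_indicator antimono_measurable \<kappa>_def mult.commute)
    also have "\<dots> \<le> tail_integral (\<lambda>t. logistic_tail (t - b)) (- x)"
      by (intro tail_integral_mono le)
    also have "\<dots> = ennreal (ln (1 + exp (b + x)))"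
      by (simp add: tail_integral_logistic)
    finally obtain q where q: "tail_integral F (- x) = ennreal q" "0 \<le> q" "q + \<kappa> \<le> ln (1 + exp (b + x))"
      using \<kappa> by (cases "tail_integral F (- x)") (auto simp: ennreal_plus[symmetric] top_unique simp del: ennreal_plus)
    have "exp (\<kappa> - ln (1 + exp (b + x))) \<le> exp (- q)" using q(3) by simp
    also have "\<dots> \<le> T_op F x"
      unfolding T_op_tail_integral using q by (intro exp_minus_ge) auto
    finally show ?thesis
      by (simp add: exp_diff K_def logistic_tail_def add.commute add_pos_pos)
  qed
  have TF': "logistic_tail (x + b) \<le> T_op F x" for x
    by (rule T_op_ge_of_le) (rule F)
  have meas: "(\<lambda>t. logistic_tail (t + b)) \<in> borel_measurable borel"
    using logistic_tail_measurable[of "-b"] by simp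
  have int: "tail_integral (\<lambda>t. logistic_tail (t + b)) y = ennreal (ln (1 + exp (- b - y)))" for y
    using tail_integral_logistic[of "-b" y] by simp
  have "ennreal (ln (1 + exp (x - (b - \<epsilon>)))) \<le> tail_integral (T_op F) (- x)"
  proof (cases "x \<le> 0")
    case True
    define s where "s = exp (x - b)"
    have s: "0 < s" by (simp add: s_def)
    have "exp (x - (b - \<epsilon>)) = exp \<epsilon> * s" by (simp add: s_def exp_add[symmetric] algebra_simps)
    also have "\<dots> \<le> K * s" using \<epsilon> s by (simp add: K_def)
    finally have "ln (1 + exp (x - (b - \<epsilon>))) \<le> ln (1 + K * s)"
      by (subst ln_le_cancel_iff) (use K s in \<open>auto simp: add_pos_pos\<close>)
    also have "\<dots> \<le> K * ln (1 + s)"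
      using mult_ln_one_plus_le[of "1 / K" "K * s"] K s by (simp add: field_simps)
    finally have "ennreal (ln (1 + exp (x - (b - \<epsilon>)))) \<le> ennreal (K * ln (1 + s))"
      by (rule ennreal_leI)
    also have "\<dots> = tail_integral (\<lambda>t. K * logistic_tail (t + b)) (- x)"
      using K by (simp add: tail_integral_cmult meas int s_def ennreal_mult add.commute)
    also have "\<dots> \<le> tail_integral (T_op F) (- x)"
      using True by (intro tail_integral_mono TF) auto
    finally show ?thesis .
  next
    case False
    define s where "s = exp (x - b)"
    have s: "0 < s" by (simp add: s_def)
    have "1 + exp (x - (b - \<epsilon>)) = 1 + exp \<epsilon> * s" by (simp add: s_def exp_add[symmetric] algebra_simps)
    also have "\<dots> \<le> exp \<epsilon> * (1 + s)" using \<epsilon>0 by (simp add: algebra_simps)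
    finally have "ln (1 + exp (x - (b - \<epsilon>))) \<le> ln (exp \<epsilon> * (1 + s))"
      by (subst ln_le_cancel_iff) (use s in \<open>auto simp: add_pos_pos\<close>)
    also have "\<dots> = \<epsilon> + ln (1 + s)" using s by (simp add: ln_mult)
    also have "\<dots> \<le> ln (1 + s) + (K - 1) * ln (1 + exp (- b))" using \<epsilon> by simp
    finally have "ennreal (ln (1 + exp (x - (b - \<epsilon>)))) \<le> ennreal (ln (1 + s) + (K - 1) * ln (1 + exp (- b)))"
      by (rule ennreal_leI)
    also have "\<dots> = ennreal (ln (1 + s)) + ennreal (K - 1) * ennreal (ln (1 + exp (- b)))"
      using K s by (simp add: ennreal_plus ennreal_mult)
    also have "\<dots> = tail_integral (\<lambda>t. logistic_tail (t + b) + (K - 1) * (logistic_tail (t + b) * indicator {0..} t)) (- x)"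
      using K False
      by (subst tail_integral_add_cmult_restrict)
        (auto simp: less_imp_le[OF logistic_tail_pos] meas int s_def add.commute)
    also have "\<dots> \<le> tail_integral (T_op F) (- x)"
      using TF TF' by (intro tail_integral_mono) (auto simp: indicator_def algebra_simps)
    finally show ?thesis .
  qed
  then show ?thesis by (intro T_op_le_logistic) (simp add: \<epsilon>_def)
qed

lemma T_op_T_op_ge:
  assumes F: "antimono F" "\<And>t. logistic_tail (t - a) \<le> F t"
    and d: "0 < d" and F0: "logistic_tail (- 2 * d - a) \<le> F 0"
  shows "logistic_tail (x - (a + lower_gain d a)) \<le> T_op (T_op F) x"
proof -
  define c where "c = logistic_tail (- 2 * d - a) - logistic_tail (- d - a)"
  define \<kappa> where "\<kappa> = d * c"
  define K where "K = exp (- \<kappa>)"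
  define \<epsilon> where "\<epsilon> = lower_gain d a"
  define l where "l = (1 - K) * ln (1 + exp (- a - d))"
  have c: "0 \<le> c" using d by (simp add: c_def logistic_tail_antimono)
  have \<kappa>: "0 \<le> \<kappa>" using c d by (simp add: \<kappa>_def)
  have K: "0 < K" "K \<le> 1" using \<kappa> by (simp_all add: K_def)
  have l0: "0 \<le> l" using K by (simp add: l_def)
  have "\<epsilon> = min \<kappa> l"
    by (simp add: \<epsilon>_def lower_gain_def Let_def K_def \<kappa>_def c_def l_def)
  then have \<epsilon>: "\<epsilon> \<le> \<kappa>" "\<epsilon> \<le> l" and \<epsilon>0: "0 \<le> \<epsilon>"
    using \<kappa> l0 by auto
  have TF: "T_op F x \<le> K * logistic_tail (x + a)" if "d \<le> x" for x
  proof -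
    have le: "logistic_tail (t - a) + c * indicator {-d..0} t \<le> F t" for t
    proof (cases "t \<in> {-d..0}")
      case True
      then have "F 0 \<le> F t" "logistic_tail (t - a) \<le> logistic_tail (- d - a)"
        using F(1) by (auto simp: antimono_def logistic_tail_antimono)
      then show ?thesis using True F0 by (simp add: c_def)
    qed (simp add: F)
    have "ennreal (ln (1 + exp (a + x)) + \<kappa>) = tail_integral (\<lambda>t. logistic_tail (t - a) + c * indicator {-d..0} t) (- x)"
      using that d c \<kappa>
      by (subst tail_integral_add)
        (auto simp: tail_integral_indicator tail_integral_logistic \<kappa>_def mult.commute ennreal_plus less_imp_le[OF logistic_tail_pos])
    also have "\<dots> \<le> tail_integral F (- x)"
      by (intro tail_integral_mono le)
    finally have "T_op F x \<le> exp (- (ln (1 + exp (a + x)) + \<kappa>))"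
      unfolding T_op_tail_integral using \<kappa> by (intro exp_minus_le) auto
    then show ?thesis
      by (simp add: exp_diff exp_minus K_def logistic_tail_def add.commute add_pos_pos field_simps)
  qed
  have TF': "T_op F x \<le> logistic_tail (x + a)" for x
    by (rule T_op_le_of_ge) (rule F)
  have meas: "(\<lambda>t. logistic_tail (t + a)) \<in> borel_measurable borel"
    using logistic_tail_measurable[of "-a"] by simp
  have int: "tail_integral (\<lambda>t. logistic_tail (t + a)) y = ennreal (ln (1 + exp (- a - y)))" for y
    using tail_integral_logistic[of "-a" y] by simp
  have "tail_integral (T_op F) (- x) \<le> ennreal (ln (1 + exp (x - (a + \<epsilon>))))"
  proof (cases "x \<le> - d")
    case True
    define s where "s = exp (x - a)"
    have s: "0 < s" by (simp add: s_def)
    have "tail_integral (T_op F) (- x) \<le> tail_integral (\<lambda>t. K * logistic_tail (t + a)) (- x)"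
      using True by (intro tail_integral_mono TF) auto
    also have "\<dots> = ennreal (K * ln (1 + s))"
      using K by (simp add: tail_integral_cmult meas int s_def ennreal_mult add.commute)
    also have "\<dots> \<le> ennreal (ln (1 + exp (x - (a + \<epsilon>))))"
    proof (rule ennreal_leI)
      have "K * ln (1 + s) \<le> ln (1 + K * s)"
        using mult_ln_one_plus_le[of K s] K s by simp
      also have "K * s \<le> exp (- \<epsilon>) * s" using \<epsilon> s by (simp add: K_def)
      then have "ln (1 + K * s) \<le> ln (1 + exp (- \<epsilon>) * s)"
        by (subst ln_le_cancel_iff) (use K s in \<open>auto simp: add_pos_pos\<close>)
      also have "exp (- \<epsilon>) * s = exp (x - (a + \<epsilon>))" by (simp add: s_def exp_add[symmetric] algebra_simps)
      finally show "K * ln (1 + s) \<le> ln (1 + exp (x - (a + \<epsilon>)))" .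
    qed
    finally show ?thesis .
  next
    case False
    define s where "s = exp (x - a)"
    have s: "0 < s" by (simp add: s_def)
    have "tail_integral (T_op F) (- x) + ennreal l
      = tail_integral (\<lambda>t. T_op F t + (1 - K) * (logistic_tail (t + a) * indicator {d..} t)) (- x)"
      using K False
      by (subst tail_integral_add_cmult_restrict)
        (auto simp: less_imp_le[OF logistic_tail_pos] meas int l_def
          T_op_bounds antimono_measurable antimono_T_op ennreal_mult)
    also have "\<dots> \<le> tail_integral (\<lambda>t. logistic_tail (t + a)) (- x)"
      using TF TF' by (intro tail_integral_mono) (auto simp: indicator_def algebra_simps)
    also have "\<dots> = ennreal (ln (1 + s))" by (simp add: int s_def)
    finally obtain q where q: "tail_integral (T_op F) (- x) = ennreal q" "0 \<le> q" "q + l \<le> ln (1 + s)"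
      using l0 s
      by (cases "tail_integral (T_op F) (- x)") (auto simp: ennreal_plus[symmetric] top_unique simp del: ennreal_plus)
    have "exp (- \<epsilon>) * (1 + s) \<le> 1 + exp (- \<epsilon>) * s" using \<epsilon>0 by (simp add: algebra_simps)
    then have "ln (exp (- \<epsilon>) * (1 + s)) \<le> ln (1 + exp (- \<epsilon>) * s)"
      by (subst ln_le_cancel_iff) (use s in \<open>auto simp: add_pos_pos\<close>)
    moreover have "ln (exp (- \<epsilon>) * (1 + s)) = ln (1 + s) - \<epsilon>" using s by (simp add: ln_mult)
    moreover have "exp (- \<epsilon>) * s = exp (x - (a + \<epsilon>))" by (simp add: s_def exp_add[symmetric] algebra_simps)
    ultimately have "q \<le> ln (1 + exp (x - (a + \<epsilon>)))" using q \<epsilon> by simp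
    then show ?thesis using q by (simp add: ennreal_leI)
  qed
  then show ?thesis by (intro T_op_ge_logistic) (simp add: \<epsilon>_def)
qed

lemma tail_integral_le_add:
  assumes F: "F \<in> borel_measurable borel" "\<And>t. 0 \<le> F t" "\<And>t. F t \<le> 1" and "y \<le> z"
  shows "tail_integral F y \<le> tail_integral F z + ennreal (z - y)"
proof -
  have "tail_integral F y \<le> tail_integral (\<lambda>t. F t * indicator {z..} t + 1 * indicator {y..z} t) y"
    using F by (intro tail_integral_mono) (auto simp: indicator_def)
  also have "\<dots> = tail_integral F z + ennreal (z - y)"
    using F \<open>y \<le> z\<close> tail_integral_indicator[of y z y 1]
    by (subst tail_integral_add) (auto simp: tail_integral_restrict)
  finally show ?thesis .
qed

lemma tail_integral_exp_decay:
  assumes "\<And>t. G t \<le> C * exp (- (q * t))" "0 \<le> C" "0 < q"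
  shows "tail_integral G y \<le> ennreal (C / q * exp (- (q * y)))"
proof -
  have "tail_integral G y \<le> tail_integral (\<lambda>t. C * exp (- (q * t))) y"
    by (intro tail_integral_mono assms)
  also have "\<dots> = ennreal (0 - (- (C / q * exp (- (q * y)))))"
    unfolding tail_integral_def
  proof (rule nn_integral_FTC_atLeast)
    show "((\<lambda>t. - (C / q * exp (- (q * t)))) has_real_derivative C * exp (- (q * t))) (at t)" for t
      using assms by (auto intro!: derivative_eq_intros)
    have "((\<lambda>t. - (C / q * inverse (exp (q * t)))) \<longlongrightarrow> - (C / q * 0)) at_top"
      using assms
      by (intro tendsto_intros tendsto_inverse_0_at_top filterlim_compose[OF exp_at_top]
          filterlim_tendsto_pos_mult_at_top[OF tendsto_const] filterlim_ident)
    then show "((\<lambda>t. - (C / q * exp (- (q * t)))) \<longlongrightarrow> 0) at_top"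
      by (simp add: exp_minus)
  qed (use assms in auto)
  finally show ?thesis by simp
qed

lemma T_op_pos:
  assumes F: "F \<in> borel_measurable borel" "\<And>t. 0 \<le> F t" "\<And>t. F t \<le> 1"
    and fin: "tail_integral F z < \<infinity>"
  shows "0 < T_op F x"
proof -
  have "tail_integral F (- x) < \<infinity>"
  proof (cases "- x \<le> z")
    case True
    have "tail_integral F z + ennreal (z - - x) < \<infinity>"
      using fin by (simp add: less_top)
    then show ?thesis
      using tail_integral_le_add[OF F True] by (simp add: order_le_less_trans)
  next
    case False
    then show ?thesis using tail_integral_antimono[of z "- x" F] fin by auto
  qed
  then show ?thesis by (simp add: T_op_tail_integral exp_minus_def)
qed

lemma T_op_exp_decay:
  assumes "antimono F" "0 \<le> F z"
  shows "T_op F x \<le> exp (- (F z * (x + z)))"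
proof (cases "- x \<le> z")
  case True
  have "ennreal (F z * (x + z)) = tail_integral (\<lambda>t. F z * indicator {-x..z} t) (- x)"
    using assms True by (simp add: tail_integral_indicator add.commute)
  also have "\<dots> \<le> tail_integral F (- x)"
    using assms unfolding tail_integral_def
    by (intro nn_integral_mono) (auto simp: indicator_def antimono_def intro!: ennreal_leI)
  finally show ?thesis
    unfolding T_op_tail_integral using assms True by (intro exp_minus_le) auto
next
  case False
  then have "F z * (x + z) \<le> 0" using assms by (intro mult_nonneg_nonpos) auto
  then have "1 \<le> exp (- (F z * (x + z)))" by simp
  then show ?thesis using T_op_bounds(2)[of F x] by linarith
qed

lemma T_op_ge_one_minus_exp:
  assumes "\<And>t. G t \<le> C * exp (- (q * t))" "0 \<le> C" "0 < q"
  shows "1 - C / q * exp (q * x) \<le> T_op G x"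
proof -
  have "exp (- (C / q * exp (q * x))) \<le> T_op G x"
    unfolding T_op_tail_integral using assms tail_integral_exp_decay[OF assms, of "- x"]
    by (intro exp_minus_ge) auto
  then show ?thesis using exp_ge_add_one_self[of "- (C / q * exp (q * x))"] by linarith
qed

lemma T_op_le_exp:
  assumes G: "G \<in> borel_measurable borel" "\<And>t. 0 \<le> G t" "\<And>t. 1 - D * exp (q * t) \<le> G t"
    and "0 \<le> D" "0 < q"
  shows "T_op G x \<le> exp (D / q - x)"
proof (cases "x \<le> D / q")
  case True
  then have "1 \<le> exp (D / q - x)" by simp
  then show ?thesis using T_op_bounds(2)[of G x] by linarith
next
  case False
  have "0 \<le> D / q" using assms by simp
  then have x: "0 \<le> x" using False by linarith
  have fin: "tail_integral (\<lambda>t. D * exp (q * t) * indicator {..0} t) (- x) \<le> ennreal (D / q)"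
  proof -
    have "tail_integral (\<lambda>t. D * exp (q * t) * indicator {..0} t) (- x)
      = (\<integral>\<^sup>+t. ennreal (D * exp (q * t)) * indicator {-x..0} t \<partial>lborel)"
      unfolding tail_integral_def by (intro nn_integral_cong) (auto simp: indicator_def)
    also have "\<dots> = ennreal (D / q * exp (q * 0) - D / q * exp (q * (- x)))"
      using assms x by (intro nn_integral_FTC_Icc) (auto intro!: derivative_eq_intros)
    also have "\<dots> \<le> ennreal (D / q)" using assms by (intro ennreal_leI) simp
    finally show ?thesis .
  qed
  have "ennreal x = tail_integral (\<lambda>t. 1 * indicator {-x..0} t) (- x)"
    using x by (subst tail_integral_indicator) auto
  also have "\<dots> \<le> tail_integral (\<lambda>t. G t + D * exp (q * t) * indicator {..0} t) (- x)"
  proof (intro tail_integral_mono)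
    show "1 * indicator {-x..0} t \<le> G t + D * exp (q * t) * indicator {..0} t" for t
      using G(2)[of t] G(3)[of t] \<open>0 \<le> D\<close> by (auto simp: indicator_def)
  qed
  also have "\<dots> = tail_integral G (- x) + tail_integral (\<lambda>t. D * exp (q * t) * indicator {..0} t) (- x)"
    using assms by (intro tail_integral_add) auto
  also have "\<dots> \<le> tail_integral G (- x) + ennreal (D / q)"
    by (intro add_left_mono fin)
  finally have "ennreal (x - D / q) \<le> tail_integral G (- x)"
    using False \<open>0 \<le> D / q\<close>
    by (cases "tail_integral G (- x)") (auto simp: ennreal_plus[symmetric] simp del: ennreal_plus)
  then have "T_op G x \<le> exp (- (x - D / q))"
    unfolding T_op_tail_integral using False by (intro exp_minus_le) auto
  then show ?thesis by simp
qed

lemma T_op_ge_logistic_of_exp: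
  assumes G: "G \<in> borel_measurable borel" "\<And>t. 0 \<le> G t" "\<And>t. G t \<le> 1" "\<And>t. G t \<le> exp (c - t)"
  shows "logistic_tail (x + c + ln 3) \<le> T_op G x"
proof -
  have decay: "tail_integral G y \<le> ennreal (exp (c - y))" for y
    using tail_integral_exp_decay[of G "exp c" 1 y] G by (simp add: exp_diff exp_minus divide_inverse)
  define u where "u = exp (c + x)"
  have u: "0 < u" by (simp add: u_def)
  have "tail_integral G (- x) \<le> ennreal (ln (1 + 3 * u))"
  proof (cases "c + x \<le> 0")
    case True
    then have u1: "u \<le> 1" by (simp add: u_def)
    have "exp u \<le> 1 + u + u\<^sup>2" using exp_bound[of u] u u1 by simp
    also have "u\<^sup>2 \<le> u" using u u1 by (simp add: power2_eq_square mult_left_le)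
    finally have "exp u \<le> 1 + 3 * u" using u by simp
    then have "u \<le> ln (1 + 3 * u)" using u by (simp add: ln_ge_iff add_pos_pos)
    then show ?thesis using decay[of "- x"] by (simp add: u_def order_trans ennreal_leI)
  next
    case False
    have "tail_integral G (- x) \<le> tail_integral G c + ennreal (c - - x)"
      using False G by (intro tail_integral_le_add) auto
    also have "\<dots> \<le> ennreal 1 + ennreal (c + x)"
      using decay[of c] by (intro add_mono) auto
    also have "\<dots> = ennreal (1 + (c + x))" using False by (subst ennreal_plus) auto
    also have "\<dots> \<le> ennreal (ln (1 + 3 * u))"
    proof (rule ennreal_leI)
      have "exp (1 + (c + x)) \<le> 3 * u"
        using exp_le u unfolding exp_add u_def by (intro mult_right_mono) auto
      then have "exp (1 + (c + x)) \<le> 1 + 3 * u" by simp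
      then show "1 + (c + x) \<le> ln (1 + 3 * u)" using u by (simp add: ln_ge_iff add_pos_pos)
    qed
    finally show ?thesis .
  qed
  also have "3 * u = exp (x - (- c - ln 3))" by (simp add: u_def exp_add exp_diff exp_minus field_simps)
  finally have "logistic_tail (x - (- c - ln 3)) \<le> T_op G x" by (rule T_op_ge_logistic)
  then show ?thesis by (simp add: algebra_simps)
qed

lemma T_op_4_ge_logistic:
  assumes F: "antimono F" and z: "0 < F z"
  obtains a where "\<And>x. logistic_tail (x - a) \<le> T_op (T_op (T_op (T_op F))) x"
proof -
  define q where "q = F z"
  define C where "C = exp (- (q * z))"
  have q: "0 < q" and C: "0 \<le> C" using z by (simp_all add: q_def C_def)
  note meas = antimono_measurable[OF antimono_T_op]
  have 1: "T_op F t \<le> C * exp (- (q * t))" for t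
    using T_op_exp_decay[OF F, of z t] z
    by (simp add: q_def C_def exp_add[symmetric] algebra_simps)
  have 2: "1 - C / q * exp (q * t) \<le> T_op (T_op F) t" for t
    using 1 C q by (rule T_op_ge_one_minus_exp)
  have 3: "T_op (T_op (T_op F)) t \<le> exp (C / q / q - t)" for t
    using C q by (intro T_op_le_exp meas T_op_bounds 2) auto
  have "logistic_tail (x - (- (C / q / q) - ln 3)) \<le> T_op (T_op (T_op (T_op F))) x" for x
    using T_op_ge_logistic_of_exp[OF meas T_op_bounds 3, of x] by (simp add: algebra_simps)
  then show ?thesis by (rule that)
qed

lemma T_op_6_logistic_bounds:
  assumes F: "antimono F" "\<And>t. 0 \<le> F t" "\<And>t. F t \<le> 1" "0 < F z" and fin: "tail_integral F y < \<infinity>"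
  obtains a b where "\<And>x. logistic_tail (x - a) \<le> (T_op ^^ 6) F x" "\<And>x. (T_op ^^ 6) F x \<le> logistic_tail (x - b)"
proof -
  have 6: "(T_op ^^ 6) F = T_op (T_op (T_op (T_op (T_op (T_op F)))))"
    by (simp add: eval_nat_numeral)
  obtain a where a: "\<And>x. logistic_tail (x - a) \<le> T_op (T_op (T_op (T_op F))) x"
    using T_op_4_ge_logistic F by blast
  have "0 < T_op F 0"
    using F fin by (intro T_op_pos antimono_measurable) auto
  then obtain b where b: "\<And>x. logistic_tail (x - b) \<le> T_op (T_op (T_op (T_op (T_op F)))) x"
    using T_op_4_ge_logistic[OF antimono_T_op] by blast
  have "T_op (T_op (T_op (T_op (T_op F)))) x \<le> logistic_tail (x - - a)" for x
    using T_op_le_of_ge[OF a] by simp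
  then have "logistic_tail (x - a) \<le> (T_op ^^ 6) F x" for x
    using T_op_ge_of_le[of "T_op (T_op (T_op (T_op (T_op F))))" "- a"] by (simp add: 6)
  moreover have "(T_op ^^ 6) F x \<le> logistic_tail (x - - b)" for x
    using T_op_le_of_ge[OF b] by (simp add: 6)
  ultimately show ?thesis by (rule that)
qed

lemma hat_bounds:
  assumes "logistic_tail (x - a) \<le> F x" "F x \<le> logistic_tail (x - b)"
  shows "ereal a \<le> hat F x" "hat F x \<le> ereal b"
proof -
  define p where "p = F x"
  have p: "0 < p" "p < 1"
    using assms logistic_tail_pos[of "x - a"] logistic_tail_less_1[of "x - b"] by (auto simp: p_def)
  then have hat: "hat F x = ereal (x + ln (p / (1 - p)))"
    by (simp add: hat_def p_def)
  have "1 \<le> p * (1 + exp (x - a))" "p * (1 + exp (x - b)) \<le> 1"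
    using assms by (simp_all add: p_def logistic_tail_def field_simps add_pos_pos)
  then have "exp (a - x) \<le> p / (1 - p)" "p / (1 - p) \<le> exp (b - x)"
    using p by (simp_all add: exp_diff field_simps)
  then have "ln (exp (a - x)) \<le> ln (p / (1 - p))" "ln (p / (1 - p)) \<le> ln (exp (b - x))"
    using p by (simp_all only: ln_le_cancel_iff exp_gt_zero divide_pos_pos diff_gt_0_iff_gt)
  then show "ereal a \<le> hat F x" "hat F x \<le> ereal b"
    by (simp_all add: hat)
qed

lemma logistic_tail_diff_le:
  assumes "x \<le> y"
  shows "logistic_tail x - logistic_tail y \<le> y - x"
proof -
  have "x + logistic_tail x \<le> y + logistic_tail y"
  proof (rule DERIV_nonneg_imp_nondecreasing[OF assms])
    fix u :: real
    have "((\<lambda>u. u + logistic_tail u) has_real_derivative 1 - exp u / (1 + exp u)\<^sup>2) (at u)"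
      unfolding logistic_tail_def[abs_def]
      by (auto intro!: derivative_eq_intros simp: power2_eq_square add_pos_pos less_imp_neq[THEN not_sym])
    moreover have "exp u \<le> (1 + exp u)\<^sup>2" by (simp add: power2_eq_square algebra_simps)
    then have "0 \<le> 1 - exp u / (1 + exp u)\<^sup>2" by (simp add: divide_le_eq)
    ultimately show "\<exists>D. ((\<lambda>u. u + logistic_tail u) has_real_derivative D) (at u) \<and> 0 \<le> D" by blast
  qed
  then show ?thesis by simp
qed

lemma logistic_squeeze:
  assumes "\<And>\<epsilon>::real. 0 < \<epsilon> \<Longrightarrow> \<forall>\<^sub>F k in sequentially. \<forall>x.
      logistic_tail (x - (\<gamma> - \<epsilon>)) \<le> G k x \<and> G k x \<le> logistic_tail (x - (\<gamma> + \<epsilon>))"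
  shows "unif_tendsto_const (\<lambda>k. hat (G k)) \<gamma>"
    and "uniform_limit UNIV G (shift \<gamma> logistic_tail) sequentially"
proof -
  show "unif_tendsto_const (\<lambda>k. hat (G k)) \<gamma>"
    unfolding unif_tendsto_const_def
  proof (intro allI impI)
    fix \<epsilon> :: real assume "0 < \<epsilon>"
    then have "0 < \<epsilon> / 2" by simp
    from assms[OF this] show "\<forall>\<^sub>F k in sequentially. \<forall>x. \<bar>hat (G k) x - ereal \<gamma>\<bar> < ereal \<epsilon>"
    proof (eventually_elim, intro allI)
      fix k x
      assume "\<forall>x. logistic_tail (x - (\<gamma> - \<epsilon> / 2)) \<le> G k x \<and> G k x \<le> logistic_tail (x - (\<gamma> + \<epsilon> / 2))"
      then have "ereal (\<gamma> - \<epsilon> / 2) \<le> hat (G k) x" "hat (G k) x \<le> ereal (\<gamma> + \<epsilon> / 2)"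
        using hat_bounds by blast+
      then show "\<bar>hat (G k) x - ereal \<gamma>\<bar> < ereal \<epsilon>"
        using \<open>0 < \<epsilon>\<close> by (cases "hat (G k) x") auto
    qed
  qed
  show "uniform_limit UNIV G (shift \<gamma> logistic_tail) sequentially"
    unfolding uniform_limit_iff
  proof (intro allI impI)
    fix \<epsilon> :: real assume "0 < \<epsilon>"
    then have "0 < \<epsilon> / 2" by simp
    from assms[OF this] show "\<forall>\<^sub>F k in sequentially. \<forall>x\<in>UNIV. dist (G k x) (shift \<gamma> logistic_tail x) < \<epsilon>"
    proof (eventually_elim, intro ballI)
      fix k x
      assume "\<forall>x. logistic_tail (x - (\<gamma> - \<epsilon> / 2)) \<le> G k x \<and> G k x \<le> logistic_tail (x - (\<gamma> + \<epsilon> / 2))"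
      then have "logistic_tail (x - (\<gamma> - \<epsilon> / 2)) \<le> G k x" "G k x \<le> logistic_tail (x - (\<gamma> + \<epsilon> / 2))"
        by blast+
      then show "dist (G k x) (shift \<gamma> logistic_tail x) < \<epsilon>"
        using logistic_tail_diff_le[of "x - \<gamma>" "x - (\<gamma> - \<epsilon> / 2)"] \<open>0 < \<epsilon>\<close>
          logistic_tail_diff_le[of "x - (\<gamma> + \<epsilon> / 2)" "x - \<gamma>"]
        by (simp add: dist_real_def shift_def abs_if)
    qed
  qed
qed

lemma upper_gain_pos: "0 < d \<Longrightarrow> 0 < upper_gain d b"
  using logistic_tail_strict_antimono[of "d - b" "2 * d - b"]
  by (simp add: upper_gain_def Let_def ln_gt_zero)

lemma lower_gain_pos: "0 < d \<Longrightarrow> 0 < lower_gain d a"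
  using logistic_tail_strict_antimono[of "- 2 * d - a" "- d - a"]
  by (simp add: lower_gain_def Let_def ln_gt_zero)

lemma isCont_logistic_tail: "isCont logistic_tail x"
  using logistic_tail_cont by (simp add: continuous_on_eq_continuous_at)

lemma isCont_upper_gain: "isCont (upper_gain d) b"
  unfolding upper_gain_def[abs_def] Let_def
  by (intro continuous_intros isCont_o2[OF _ isCont_logistic_tail]) (simp add: add_pos_pos less_imp_neq[THEN not_sym])

lemma isCont_lower_gain: "isCont (lower_gain d) a"
  unfolding lower_gain_def[abs_def] Let_def
  by (intro continuous_intros isCont_o2[OF _ isCont_logistic_tail]) (simp add: add_pos_pos less_imp_neq[THEN not_sym])

lemma isCont_less_nbhd:
  fixes f :: "real \<Rightarrow> real"
  assumes "isCont f p" "f p < c"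
  obtains \<eta> where "0 < \<eta>" "\<And>x. \<bar>x - p\<bar> < \<eta> \<Longrightarrow> f x < c"
proof -
  have "\<forall>\<^sub>F x in nhds p. f x < c"
    using assms by (auto simp: isCont_def tendsto_at_iff_tendsto_nhds intro: order_tendstoD)
  then show ?thesis
    using that by (auto simp: eventually_nhds_metric dist_real_def)
qed

lemma even_iterates_logistic_squeeze:
  assumes E: "\<And>k. antimono (E k)" "\<And>k t. 0 \<le> E k t" "\<And>k. E (Suc k) = T_op (T_op (E k))"
    and init: "\<And>x. logistic_tail (x - a0) \<le> E k0 x" "\<And>x. E k0 x \<le> logistic_tail (x - b0)"
  obtains \<gamma> :: real where "\<And>\<epsilon>. 0 < \<epsilon> \<Longrightarrow> \<forall>\<^sub>F k in sequentially. \<forall>x.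
      logistic_tail (x - (\<gamma> - \<epsilon>)) \<le> E k x \<and> E k x \<le> logistic_tail (x - (\<gamma> + \<epsilon>))"
proof -
  define U where "U = {b. \<exists>k. \<forall>x. E k x \<le> logistic_tail (x - b)}"
  define L where "L = {a. \<exists>k. \<forall>x. logistic_tail (x - a) \<le> E k x}"
  have stepU: "\<forall>x. E (Suc k) x \<le> logistic_tail (x - b)" if "\<forall>x. E k x \<le> logistic_tail (x - b)" for k b
    using T_op_le_of_ge[of "-b" "T_op (E k)"] T_op_ge_of_le[of "E k" b] that by (simp add: E(3))
  have stepL: "\<forall>x. logistic_tail (x - a) \<le> E (Suc k) x" if "\<forall>x. logistic_tail (x - a) \<le> E k x" for k a
    using T_op_ge_of_le[of "T_op (E k)" "-a"] T_op_le_of_ge[of a "E k"] that by (simp add: E(3))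
  have U_eventually: "\<exists>K. \<forall>k\<ge>K. \<forall>x. E k x \<le> logistic_tail (x - b)" if bU: "b \<in> U" for b
  proof -
    obtain K where K: "\<forall>x. E K x \<le> logistic_tail (x - b)" using bU by (auto simp: U_def)
    have "\<forall>x. E k x \<le> logistic_tail (x - b)" if "K \<le> k" for k
      using that K by (induction rule: dec_induct) (auto dest: stepU)
    then show ?thesis by blast
  qed
  have L_eventually: "\<exists>K. \<forall>k\<ge>K. \<forall>x. logistic_tail (x - a) \<le> E k x" if aL: "a \<in> L" for a
  proof -
    obtain K where K: "\<forall>x. logistic_tail (x - a) \<le> E K x" using aL by (auto simp: L_def)
    have "\<forall>x. logistic_tail (x - a) \<le> E k x" if "K \<le> k" for k
      using that K by (induction rule: dec_induct) (auto dest: stepL)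
    then show ?thesis by blast
  qed
  have common: "\<exists>k. (\<forall>x. logistic_tail (x - a) \<le> E k x) \<and> (\<forall>x. E k x \<le> logistic_tail (x - b))"
    if "a \<in> L" "b \<in> U" for a b
    using L_eventually[OF that(1)] U_eventually[OF that(2)] by (meson nle_le order_trans)
  have LU: "a \<le> b" if "a \<in> L" "b \<in> U" for a b
  proof (rule ccontr)
    assume "\<not> a \<le> b"
    then have "logistic_tail (0 - b) < logistic_tail (0 - a)"
      using logistic_tail_strict_antimono[of "- a" "- b"] by simp
    then show False using common[OF that] by (meson leD order_trans)
  qed
  have a0: "a0 \<in> L" and b0: "b0 \<in> U" using init by (auto simp: L_def U_def)
  define m where "m = Sup L"
  define M where "M = Inf U"
  have bddL: "bdd_above L" and bddU: "bdd_below U"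
    using LU a0 b0 by (auto simp: bdd_above_def bdd_below_def)
  have m_upper: "a \<le> m" if "a \<in> L" for a
    unfolding m_def using that bddL by (rule cSup_upper)
  have M_lower: "M \<le> b" if "b \<in> U" for b
    unfolding M_def using that bddU by (rule cInf_lower)
  have near_M: "\<exists>b\<in>U. b < M + \<eta>" if "0 < \<eta>" for \<eta>
    using cInf_lessD[of U "M + \<eta>"] b0 that by (auto simp: M_def)
  have near_m: "\<exists>a\<in>L. m - \<eta> < a" if "0 < \<eta>" for \<eta>
    using less_cSupD[of L "m - \<eta>"] a0 that by (auto simp: m_def)
  have "m \<le> M"
    unfolding m_def M_def using a0 b0 LU by (intro cSup_least cInf_greatest) auto
  moreover have "\<not> m < M"
  proof
    assume "m < M"
    define d where "d = (M - m) / 4"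
    have d: "0 < d" using \<open>m < M\<close> by (simp add: d_def)
    have mid: "M - 2 * d = m + 2 * d" by (simp add: d_def field_simps)
    obtain \<eta>1 where \<eta>1: "0 < \<eta>1" "\<And>b. \<bar>b - M\<bar> < \<eta>1 \<Longrightarrow> b - upper_gain d b < M"
      by (rule isCont_less_nbhd[of M "\<lambda>b. b - upper_gain d b" M])
        (auto intro!: continuous_intros isCont_upper_gain upper_gain_pos d)
    obtain \<eta>2 where \<eta>2: "0 < \<eta>2" "\<And>a. \<bar>a - m\<bar> < \<eta>2 \<Longrightarrow> - (a + lower_gain d a) < - m"
      by (rule isCont_less_nbhd[of m "\<lambda>a. - (a + lower_gain d a)" "- m"])
        (auto intro!: continuous_intros isCont_lower_gain lower_gain_pos d)
    obtain b where b: "b \<in> U" "b < M + \<eta>1" using near_M \<eta>1 by blast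
    obtain a where a: "a \<in> L" "m - \<eta>2 < a" using near_m \<eta>2 by blast
    have Mb: "M \<le> b" and am: "a \<le> m" using b a M_lower m_upper by auto
    obtain k where k: "\<And>x. logistic_tail (x - a) \<le> E k x" "\<And>x. E k x \<le> logistic_tail (x - b)"
      using common[OF a(1) b(1)] by blast
    show False
    proof (cases "E k 0 \<le> logistic_tail (2 * d - M)")
      case True
      have "logistic_tail (2 * d - M) \<le> logistic_tail (2 * d - b)"
        using Mb by (intro logistic_tail_antimono) auto
      with True have "E k 0 \<le> logistic_tail (2 * d - b)" by simp
      from T_op_T_op_le[OF E(1,2) k(2) d this]
      have "b - upper_gain d b \<in> U" by (auto simp: U_def E(3)[symmetric])
      then show False using M_lower \<eta>1(2)[of b] Mb b by force
    next
      case False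
      have "logistic_tail (- 2 * d - a) \<le> logistic_tail (- 2 * d - m)"
        using am by (intro logistic_tail_antimono) auto
      also have "- 2 * d - m = 2 * d - M" using mid by simp
      finally have "logistic_tail (- 2 * d - a) \<le> E k 0" using False by simp
      from T_op_T_op_ge[OF E(1) k(1) d this]
      have "a + lower_gain d a \<in> L" by (auto simp: L_def E(3)[symmetric])
      then show False using m_upper \<eta>2(2)[of a] am a by force
    qed
  qed
  ultimately have mM: "m = M" by simp
  show ?thesis
  proof (rule that[of M])
    fix \<epsilon> :: real assume "0 < \<epsilon>"
    then obtain a b where "a \<in> L" "M - \<epsilon> < a" "b \<in> U" "b < M + \<epsilon>"
      using near_M[of \<epsilon>] near_m[of \<epsilon>] mM by auto
    then have "\<forall>\<^sub>F k in sequentially. \<forall>x. logistic_tail (x - a) \<le> E k x"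
      "\<forall>\<^sub>F k in sequentially. \<forall>x. E k x \<le> logistic_tail (x - b)"
      using L_eventually U_eventually by (auto simp: eventually_sequentially)
    then show "\<forall>\<^sub>F k in sequentially. \<forall>x.
      logistic_tail (x - (M - \<epsilon>)) \<le> E k x \<and> E k x \<le> logistic_tail (x - (M + \<epsilon>))"
    proof eventually_elim
      case (elim k)
      show ?case
      proof
        fix x
        have "logistic_tail (x - (M - \<epsilon>)) \<le> logistic_tail (x - a)"
          using \<open>M - \<epsilon> < a\<close> by (intro logistic_tail_antimono) auto
        moreover have "logistic_tail (x - b) \<le> logistic_tail (x - (M + \<epsilon>))"
          using \<open>b < M + \<epsilon>\<close> by (intro logistic_tail_antimono) auto
        ultimately show "logistic_tail (x - (M - \<epsilon>)) \<le> E k x \<and> E k x \<le> logistic_tail (x - (M + \<epsilon>))"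
          using elim by (meson order_trans)
      qed
    qed
  qed
qed

lemma T_op_zero: "T_op (\<lambda>_. 0) = (\<lambda>_. 1)"
  by (auto simp: T_op_def exp_minus_def)

lemma T_op_eq_zero:
  assumes F: "F \<in> borel_measurable borel" "\<And>t. 0 \<le> F t" "\<And>t. F t \<le> 1"
    and inf: "tail_integral F z = \<infinity>"
  shows "T_op F = (\<lambda>_. 0)"
proof
  fix x
  show "T_op F x = 0"
  proof (rule ccontr)
    assume "T_op F x \<noteq> 0"
    then have "tail_integral F (- x) < \<infinity>"
      by (auto simp: T_op_tail_integral exp_minus_def less_top split: if_splits)
    then have "tail_integral F z < \<infinity>"
      using tail_integral_le_add[OF F, of z "- x"] tail_integral_antimono[of "- x" z F]
      by (cases "z \<le> - x") (auto simp: less_top[symmetric] top_unique)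
    then show False using inf by simp
  qed
qed

lemma T_op_one: "T_op (\<lambda>_. 1) = (\<lambda>_. 0)"
proof (rule T_op_eq_zero[where z = 0])
  show "tail_integral (\<lambda>_. 1) 0 = \<infinity>"
  proof (cases "tail_integral (\<lambda>_. 1) 0")
    case (real q)
    have "ennreal (q + 1) = tail_integral (\<lambda>t. 1 * indicator {0..q + 1} t) 0"
      using real by (subst tail_integral_indicator) auto
    also have "\<dots> \<le> tail_integral (\<lambda>_. 1) 0"
      by (intro tail_integral_mono) (auto simp: indicator_def)
    finally show ?thesis using real by simp
  qed simp
qed auto

theorem theorem5p1:
  fixes F :: "real \<Rightarrow> real"
  assumes "F \<in> tail_functions"
  shows "(F \<noteq> (\<lambda>_. 0) \<and> (\<integral>\<^sup>+t\<in>{0..}. ennreal (F t) \<partial>lborel) < \<infinity> \<longrightarrow>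
           (\<exists>\<gamma>::real.
              unif_tendsto_const (\<lambda>k. hat ((T_op ^^ (2 * k)) F)) \<gamma> \<and>
              unif_tendsto_const (\<lambda>k. hat ((T_op ^^ (2 * k + 1)) F)) (- \<gamma>) \<and>
              uniform_limit UNIV (\<lambda>k. (T_op ^^ (2 * k)) F) (shift \<gamma> logistic_tail) sequentially \<and>
              uniform_limit UNIV (\<lambda>k. (T_op ^^ (2 * k + 1)) F) (shift (- \<gamma>) logistic_tail) sequentially)) \<and>
         (F = (\<lambda>_. 0) \<or> (\<integral>\<^sup>+t\<in>{0..}. ennreal (F t) \<partial>lborel) = \<infinity> \<longrightarrow>
           (\<forall>k\<ge>1. ((T_op ^^ k) F = (\<lambda>_. 0) \<and> (T_op ^^ (k + 1)) F = (\<lambda>_. 1)) \<or>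
                   ((T_op ^^ k) F = (\<lambda>_. 1) \<and> (T_op ^^ (k + 1)) F = (\<lambda>_. 0))))"
proof (intro conjI impI)
  have F: "antimono F" "\<And>t. 0 \<le> F t" "\<And>t. F t \<le> 1"
    using assms by (auto simp: tail_functions_def)
  {
    assume "F \<noteq> (\<lambda>_. 0) \<and> (\<integral>\<^sup>+t\<in>{0..}. ennreal (F t) \<partial>lborel) < \<infinity>"
    then obtain z where z: "F z \<noteq> 0" and fin: "tail_integral F 0 < \<infinity>"
      by (auto simp: tail_integral_def)
    from z F(2)[of z] have "0 < F z" by linarith
    then obtain a b where ab: "\<And>x. logistic_tail (x - a) \<le> (T_op ^^ (2 * 3)) F x"
      "\<And>x. (T_op ^^ (2 * 3)) F x \<le> logistic_tail (x - b)"
      using T_op_6_logistic_bounds[OF F _ fin] by auto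
    have "antimono ((T_op ^^ n) F)" "0 \<le> (T_op ^^ n) F t" for n t
      using F by (cases n; simp add: antimono_T_op T_op_bounds)+
    then obtain \<gamma> where even: "\<And>\<epsilon>. 0 < \<epsilon> \<Longrightarrow> \<forall>\<^sub>F k in sequentially. \<forall>x.
        logistic_tail (x - (\<gamma> - \<epsilon>)) \<le> (T_op ^^ (2 * k)) F x \<and> (T_op ^^ (2 * k)) F x \<le> logistic_tail (x - (\<gamma> + \<epsilon>))"
      by (rule even_iterates_logistic_squeeze[of "\<lambda>k. (T_op ^^ (2 * k)) F" _ 3, OF _ _ _ ab]) auto
    have odd: "\<forall>\<^sub>F k in sequentially. \<forall>x.
        logistic_tail (x - (- \<gamma> - \<epsilon>)) \<le> (T_op ^^ (2 * k + 1)) F x \<and> (T_op ^^ (2 * k + 1)) F x \<le> logistic_tail (x - (- \<gamma> + \<epsilon>))"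
      if "0 < \<epsilon>" for \<epsilon>
      using even[OF that]
    proof eventually_elim
      case (elim k)
      then show ?case
        using T_op_ge_of_le[of "(T_op ^^ (2 * k)) F" "\<gamma> + \<epsilon>"] T_op_le_of_ge[of "\<gamma> - \<epsilon>" "(T_op ^^ (2 * k)) F"]
        by (simp add: algebra_simps)
    qed
    show "\<exists>\<gamma>::real.
        unif_tendsto_const (\<lambda>k. hat ((T_op ^^ (2 * k)) F)) \<gamma> \<and>
        unif_tendsto_const (\<lambda>k. hat ((T_op ^^ (2 * k + 1)) F)) (- \<gamma>) \<and>
        uniform_limit UNIV (\<lambda>k. (T_op ^^ (2 * k)) F) (shift \<gamma> logistic_tail) sequentially \<and>
        uniform_limit UNIV (\<lambda>k. (T_op ^^ (2 * k + 1)) F) (shift (- \<gamma>) logistic_tail) sequentially"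
      using logistic_squeeze[OF even] logistic_squeeze[OF odd] by blast
  next
    assume "F = (\<lambda>_. 0) \<or> (\<integral>\<^sup>+t\<in>{0..}. ennreal (F t) \<partial>lborel) = \<infinity>"
    then have 1: "T_op F = (\<lambda>_. 0) \<or> T_op F = (\<lambda>_. 1)"
      using T_op_zero T_op_eq_zero[OF antimono_measurable F(2,3)] F(1)
      by (auto simp: tail_integral_def)
    show "\<forall>k\<ge>1. ((T_op ^^ k) F = (\<lambda>_. 0) \<and> (T_op ^^ (k + 1)) F = (\<lambda>_. 1)) \<or>
        ((T_op ^^ k) F = (\<lambda>_. 1) \<and> (T_op ^^ (k + 1)) F = (\<lambda>_. 0))"
    proof (intro allI impI)
      fix k :: nat assume "1 \<le> k"
      then have "(T_op ^^ k) F = (\<lambda>_. 0) \<or> (T_op ^^ k) F = (\<lambda>_. 1)"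
        by (induction rule: dec_induct) (use 1 T_op_zero T_op_one in auto)
      then show "((T_op ^^ k) F = (\<lambda>_. 0) \<and> (T_op ^^ (k + 1)) F = (\<lambda>_. 1)) \<or>
          ((T_op ^^ k) F = (\<lambda>_. 1) \<and> (T_op ^^ (k + 1)) F = (\<lambda>_. 0))"
        using T_op_zero T_op_one by auto
    qed
  }
qed

end
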